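(* For any positive integers $k,n$ with $k\le n$, $$ex_v(\overrightarrow{P_k},\overrightarrow{Q_n})=\max_{j\in [k]}\left\{\sum_{\substack{0\le i\le n\\ i\not\equiv j \pmod k}}\binom{n}{i}\right\}.$$
   Context: The oriented hypercube $\overrightarrow{Q_n}$ has vertex set $\{0,1\}^n$ (identified with the subsets of $[n]$); for every $A\subseteq[n]$ and $x\notin A$ there is a directed edge from $A$ to $A\cup\{x\}$, and no other edges. $\overrightarrow{P_k}$ is the directed path on $k$ vertices $v_1,\dots,v_k$ with edges from $v_i$ to $v_{i+1}$ for each $i<k$. For an oriented graph $\overrightarrow{F}$, $ex_v(\overrightarrow{F},\overrightarrow{Q_n})$ is the maximum size of a vertex subset $U$ of $\overrightarrow{Q_n}$ such that the induced subgraph $\overrightarrow{Q_n}[U]$ contains no subgraph isomorphic to $\overrightarrow{F}$ as a directed graph. $[k]=\{1,\dots,k\}$. *)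

theory Defs
  imports "Graph_Theory.Digraph_Isomorphism" "HOL-Number_Theory.Cong"
begin

definition oriented_hypercube :: "nat \<Rightarrow> (nat set, nat set \<times> nat set) pre_digraph" where
  "oriented_hypercube n =
    \<lparr> verts = Pow {1..n},
      arcs = {(A, A \<union> {x}) | A x. A \<subseteq> {1..n} \<and> x \<in> {1..n} \<and> x \<notin> A},
      tail = fst, head = snd \<rparr>"

definition directed_path :: "nat \<Rightarrow> (nat, nat \<times> nat) pre_digraph" where
  "directed_path k =
    \<lparr> verts = {1..k}, arcs = {(i, i + 1) | i. 1 \<le> i \<and> i < k}, tail = fst, head = snd \<rparr>"

text \<open>Well-formedness matters because \<^const>\<open>subgraph\<close> demands it of both digraphs.\<close>

lemma wf_oriented_hypercube: "wf_digraph (oriented_hypercube n)"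
  by unfold_locales (auto simp: oriented_hypercube_def)

lemma wf_directed_path: "wf_digraph (directed_path k)"
  by unfold_locales (auto simp: directed_path_def)

text \<open>Subgraphs are not required to be induced.\<close>

definition contains_copy :: "('a, 'b) pre_digraph \<Rightarrow> ('c, 'd) pre_digraph \<Rightarrow> bool" where
  "contains_copy G F \<longleftrightarrow> (\<exists>H. subgraph H G \<and> digraph_iso F H)"

text \<open>The maximum is meaningful only if \<open>G\<close> has finitely many vertices and some vertex
  subset is \<open>F\<close>-free; the empty subset is one as soon as \<open>F\<close> has a vertex.\<close>

definition ex_v :: "('c, 'd) pre_digraph \<Rightarrow> ('a, 'b) pre_digraph \<Rightarrow> nat" where
  "ex_v F G = Max {card U | U. U \<subseteq> verts G \<and> \<not> contains_copy (G \<restriction> U) F}"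

end

theory Submission
  imports Defs "HOL-Combinatorics.Multiset_Permutations"
begin

text \<open>
  A \<open>P\<^sub>k\<close>-free set \<open>U\<close> omits a level of every window of \<open>k\<close> consecutive levels
  along each maximal chain. Weight a set of size \<open>i\<close> by \<open>n choose i\<close>. Every set of size \<open>i\<close>
  lies on \<open>i! (n - i)!\<close> of the \<open>n!\<close> maximal chains, so the size of \<open>U\<close> is the average, over
  all maximal chains, of the weight of \<open>U\<close> on the chain. It remains to see that the omitted
  levels weigh at least as much as some full residue class modulo \<open>k\<close>. Take the class of the
  largest omitted level \<open>a\<close> up to the middle, or of the least omitted level \<open>a\<close> if all
  lie above the middle: by unimodality each member of the class is outweighed
  by an omitted level lying less than \<open>k\<close> steps from it towards \<open>a\<close>, and these
  omitted levels are distinct. Conversely, deleting a residue class of levels destroys all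
  copies of \<open>P\<^sub>k\<close>.
\<close>

section \<open>Residue classes against hitting sets of windows\<close>

lemma cong_less_imp_add_le:
  fixes c d k :: nat
  assumes "[c = d] (mod k)" "c < d"
  shows "c + k \<le> d"
proof -
  have "k dvd d - c"
    using assms by (metis cong_altdef_nat cong_sym less_imp_le)
  then have "k \<le> d - c"
    using assms(2) by (intro dvd_imp_le) auto
  then show ?thesis using assms(2) by simp
qed

text \<open>Purely numerical core, applied below with \<open>w\<close> a row of binomial
  coefficients, \<open>m\<close> its middle and \<open>S\<close> the levels that a path-free family
  omits on one chain.\<close>

lemma residue_class_le_hitting_set:
  fixes w :: "nat \<Rightarrow> nat"
  assumes up: "\<And>i j. i \<le> j \<Longrightarrow> j \<le> m \<Longrightarrow> w i \<le> w j"
    and down: "\<And>i j. m \<le> i \<Longrightarrow> i \<le> j \<Longrightarrow> j \<le> n \<Longrightarrow> w j \<le> w i"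
    and S: "S \<subseteq> {..n}"
    and hit: "\<And>a. a + k \<le> n + 1 \<Longrightarrow> S \<inter> {a..<a + k} \<noteq> {}"
    and k: "0 < k" "k \<le> n + 1"
  shows "\<exists>a. (\<Sum>i | i \<le> n \<and> [i = a] (mod k). w i) \<le> sum w S"
proof -
  have fin: "finite S" using S finite_subset by blast
  have ne: "S \<noteq> {}" using hit[of 0] k by auto
  \<comment> \<open>By \<open>right\<close>, every element of \<open>S\<close> beyond
    \<open>a\<close> lies on the descending side of \<open>w\<close>. By \<open>left\<close>,
    everything up to \<open>a\<close> lies on the ascending side, unless \<open>a\<close> is the
    least element of \<open>S\<close>.\<close>
  obtain a where a: "a \<in> S" and right: "\<And>s. s \<in> S \<Longrightarrow> a < s \<Longrightarrow> m < s"
    and left: "a \<le> m \<or> (\<forall>s\<in>S. a \<le> s)"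
  proof (cases "S \<inter> {..m} = {}")
    case True
    have "Min S \<in> S" using fin ne by simp
    moreover have "\<forall>s\<in>S. Min S \<le> s" using fin by simp
    moreover have "m < s" if "s \<in> S" for s using True that by force
    ultimately show thesis using that by blast
  next
    case False
    define b where "b = Max (S \<inter> {..m})"
    have "b \<in> S \<inter> {..m}" unfolding b_def using fin False by (intro Max_in) auto
    moreover have "m < s" if "s \<in> S" "b < s" for s
    proof (rule ccontr)
      assume "\<not> m < s"
      then have "s \<le> b" unfolding b_def using fin that by (intro Max_ge) auto
      then show False using that by simp
    qed
    ultimately show thesis using that by blast
  qed
  define C where "C = {i. i \<le> n \<and> [i = a] (mod k)}"
  \<comment> \<open>Each member of the class of \<open>a\<close> picks an element of
    \<open>S\<close> in the window of length \<open>k\<close> that starts at it and runs towards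
    \<open>a\<close>. The window does not pass \<open>a\<close>, because \<open>c\<close> is either
    \<open>a\<close> itself or at least \<open>k\<close> away from it.\<close>
  have "\<forall>c\<in>C. \<exists>s\<in>S. if c \<le> a then c \<le> s \<and> s < c + k \<and> s \<le> a else a < s \<and> s \<le> c \<and> c < s + k"
  proof
    fix c assume c: "c \<in> C"
    consider "c < a" | "c = a" | "a < c" by linarith
    then show "\<exists>s\<in>S. if c \<le> a then c \<le> s \<and> s < c + k \<and> s \<le> a
      else a < s \<and> s \<le> c \<and> c < s + k"
    proof cases
      case 1
      then have "c + k \<le> a" using c by (auto simp: C_def intro: cong_less_imp_add_le)
      moreover have "a \<le> n" using a S by auto
      ultimately obtain s where "s \<in> S" "c \<le> s" "s < c + k" using hit[of c] by auto
      then show ?thesis using 1 \<open>c + k \<le> a\<close> by auto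
    next
      case 2
      then show ?thesis using a k by auto
    next
      case 3
      then have ck: "a + k \<le> c"
        using c by (auto simp: C_def intro: cong_less_imp_add_le cong_sym)
      moreover have "c \<le> n" using c by (simp add: C_def)
      \<comment> \<open>This is the window ending at \<open>c\<close>. As
        \<open>a + k \<le> c\<close>, the subtraction is not truncated and the window starts above
        \<open>a\<close>.\<close>
      ultimately obtain s where "s \<in> S" "c + 1 - k \<le> s" "s < c + 1 - k + k"
        using hit[of "c + 1 - k"] by auto
      then show ?thesis using 3 ck by (intro bexI[of _ s]) auto
    qed
  qed
  then obtain g where g: "\<And>c. c \<in> C \<Longrightarrow> g c \<in> S"
    and g_le: "\<And>c. c \<in> C \<Longrightarrow> c \<le> a \<Longrightarrow> c \<le> g c \<and> g c < c + k \<and> g c \<le> a"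
    and g_gt: "\<And>c. c \<in> C \<Longrightarrow> a < c \<Longrightarrow> a < g c \<and> g c \<le> c \<and> c < g c + k"
    by (metis (no_types, lifting) linorder_not_le)
  have gap: "c + k \<le> d" if "c \<in> C" "d \<in> C" "c < d" for c d
    using that unfolding C_def by (metis (mono_tags, lifting) cong_less_imp_add_le cong_sym cong_trans mem_Collect_eq)
  \<comment> \<open>On one side of \<open>a\<close> the windows of distinct members are disjoint,
    since the members are \<open>k\<close> apart; across \<open>a\<close> the value \<open>a\<close>
    separates the images.\<close>
  have mono: "g c < g d" if "c \<in> C" "d \<in> C" "c < d" for c d
  proof -
    consider "d \<le> a" | "c \<le> a" "a < d" | "a < c" using that by linarith
    then show ?thesis
      using gap[OF that] g_le[OF that(1)] g_le[OF that(2)] g_gt[OF that(1)] g_gt[OF that(2)] \<open>c < d\<close>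
      by cases auto
  qed
  have inj: "inj_on g C"
    by (rule linorder_inj_onI') (use mono in force)
  have le: "w c \<le> w (g c)" if c: "c \<in> C" for c
  proof (cases "c \<le> a")
    case True
    show ?thesis
    proof (cases "a \<le> m")
      case True
      then show ?thesis using g_le[OF c \<open>c \<le> a\<close>] by (intro up) auto
    next
      case False
      \<comment> \<open>Here \<open>a\<close> is the least element of \<open>S\<close>. A class
        member below \<open>a\<close> would have a window that ends before \<open>a\<close> and so
        misses \<open>S\<close>; only \<open>c = a\<close> remains.\<close>
      then have "g c = a" using left g[OF c] g_le[OF c \<open>c \<le> a\<close>] by (metis le_antisym)
      have "c = a"
      proof (rule ccontr)
        assume "c \<noteq> a"
        then have "c + k \<le> a" using \<open>c \<le> a\<close> c by (auto simp: C_def intro: cong_less_imp_add_le)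
        then show False using g_le[OF c \<open>c \<le> a\<close>] \<open>g c = a\<close> by simp
      qed
      then show ?thesis using \<open>g c = a\<close> by simp
    qed
  next
    case False
    then have "a < g c" "g c \<le> c" using g_gt[OF c] by auto
    moreover have "m < g c" using right g[OF c] \<open>a < g c\<close> by blast
    ultimately show ?thesis using c by (intro down) (auto simp: C_def)
  qed
  have "sum w C \<le> (\<Sum>c\<in>C. w (g c))" using le by (rule sum_mono)
  also have "\<dots> = sum w (g ` C)" using inj by (simp add: sum.reindex)
  also have "\<dots> \<le> sum w S" using fin g by (intro sum_mono2) auto
  finally show ?thesis unfolding C_def by blast
qed

section \<open>Copies of the directed path as sequences of sets\<close>

text \<open>The sets grow strictly along \<open>f\<close>, which makes \<open>f\<close> injective.
  Arcs are pairs of their ends, so the vertex map determines the arc map.\<close>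

lemma contains_directed_path_iff:
  assumes U: "U \<subseteq> Pow {1..n}"
  shows "contains_copy (oriented_hypercube n \<restriction> U) (directed_path k) \<longleftrightarrow>
    (\<exists>f. (\<forall>i\<in>{1..k}. f i \<in> U) \<and> (\<forall>i\<in>{1..<k}. \<exists>x. x \<notin> f i \<and> f (i + 1) = insert x (f i)))"
    (is "?L \<longleftrightarrow> ?R")
proof
  assume ?L
  then obtain h where iso: "pre_digraph.digraph_isomorphism (directed_path k) h"
    and sub: "subgraph (app_iso h (directed_path k)) (oriented_hypercube n \<restriction> U)"
    unfolding contains_copy_def digraph_iso_def by blast
  \<comment> \<open>A subgraph must be \<open>compatible\<close> with its host, which forces the
    tail and head maps of the image to be those of the hypercube.\<close>
  have ht: "iso_tail h = fst" "iso_head h = snd"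
    using sub by (auto simp: subgraph_def compatible_def oriented_hypercube_def)
  have "iso_verts h i \<in> U" if "i \<in> {1..k}" for i
    using sub that by (auto simp: subgraph_def directed_path_def)
  moreover have "\<exists>x. x \<notin> iso_verts h i \<and> iso_verts h (i + 1) = insert x (iso_verts h i)"
    if i: "i \<in> {1..<k}" for i
  proof -
    have e: "(i, i + 1) \<in> arcs (directed_path k)" using i by (auto simp: directed_path_def)
    then have "iso_arcs h (i, i + 1) \<in> arcs (oriented_hypercube n)"
      using sub by (auto simp: subgraph_def)
    moreover have "fst (iso_arcs h (i, i + 1)) = iso_verts h i"
      "snd (iso_arcs h (i, i + 1)) = iso_verts h (i + 1)"
      using pre_digraph.iso_verts_tail[OF iso e] pre_digraph.iso_verts_head[OF iso e] ht
      by (simp_all add: directed_path_def)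
    ultimately show ?thesis unfolding oriented_hypercube_def by force
  qed
  ultimately show ?R by (intro exI[of _ "iso_verts h"]) blast
next
  assume ?R
  then obtain f where fU: "\<And>i. i \<in> {1..k} \<Longrightarrow> f i \<in> U"
    and step: "\<And>i. i \<in> {1..<k} \<Longrightarrow> \<exists>x. x \<notin> f i \<and> f (i + 1) = insert x (f i)"
    by blast
  have psub: "f i \<subset> f j" if "i < j" "i \<in> {1..k}" "j \<in> {1..k}" for i j
    using that
  proof (induction j)
    case (Suc j)
    have "f j \<subset> f (Suc j)" using step[of j] Suc.prems by auto
    moreover have "i = j \<or> f i \<subset> f j" using Suc by (cases "i = j") auto
    ultimately show ?case by auto
  qed simp
  have inj: "inj_on f {1..k}"
    by (rule linorder_inj_onI') (use psub in blast)
  have arc: "(f i, f (i + 1)) \<in> arcs (oriented_hypercube n \<restriction> U)" if i: "i \<in> {1..<k}" for i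
  proof -
    have fi: "f i \<in> U" "f (i + 1) \<in> U" using i fU[of i] fU[of "i + 1"] by auto
    obtain x where x: "x \<notin> f i" "f (i + 1) = f i \<union> {x}" using step[OF i] by auto
    then have "x \<in> {1..n}" "f i \<subseteq> {1..n}" using fi U by blast+
    then have "(f i, f (i + 1)) \<in> arcs (oriented_hypercube n)"
      using x unfolding oriented_hypercube_def by auto
    then show ?thesis using fi by (simp add: oriented_hypercube_def)
  qed
  define h where "h = \<lparr> iso_verts = f, iso_arcs = map_prod f f, iso_head = snd, iso_tail = fst \<rparr>"
  have iso: "pre_digraph.digraph_isomorphism (directed_path k) h"
    unfolding pre_digraph.digraph_isomorphism_def
  proof (intro conjI)
    show "inj_on (iso_arcs h) (arcs (directed_path k))"
      unfolding h_def directed_path_def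
      by (simp, rule inj_on_subset[OF map_prod_inj_on[OF inj inj]]) auto
  qed (use inj wf_directed_path in \<open>auto simp: h_def directed_path_def\<close>)
  have "subgraph (app_iso h (directed_path k)) (oriented_hypercube n \<restriction> U)"
    unfolding subgraph_def
  proof (intro conjI)
    show "wf_digraph (oriented_hypercube n \<restriction> U)"
      using wf_oriented_hypercube by (rule wf_digraph.wellformed_induce_subgraph)
    show "wf_digraph (app_iso h (directed_path k))"
      using wf_directed_path iso by (rule wf_digraph.wf_digraphI_app_iso)
    show "arcs (app_iso h (directed_path k)) \<subseteq> arcs (oriented_hypercube n \<restriction> U)"
      using arc by (auto simp: h_def directed_path_def simp del: induce_subgraph_arcs)
  qed (use fU in \<open>auto simp: h_def directed_path_def compatible_def oriented_hypercube_def\<close>)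
  then show ?L using iso unfolding contains_copy_def digraph_iso_def by blast
qed

section \<open>Maximal chains encoded as permutations\<close>

text \<open>A permutation stands for the maximal chain of its prefix sets. The chain passes through
  \<open>A\<close> exactly when the list is an ordering of \<open>A\<close> followed by an ordering
  of \<open>X - A\<close>.\<close>

lemma card_permutations_with_prefix:
  assumes "finite X" "A \<subseteq> X"
  shows "card {xs \<in> permutations_of_set X. set (take (card A) xs) = A}
    = fact (card A) * fact (card X - card A)"
proof -
  have finA: "finite A" using assms finite_subset by blast
  have "bij_betw (\<lambda>(ys, zs). ys @ zs) (permutations_of_set A \<times> permutations_of_set (X - A))
    {xs \<in> permutations_of_set X. set (take (card A) xs) = A}"
  proof (rule bij_betw_byWitness[where f' = "\<lambda>xs. (take (card A) xs, drop (card A) xs)"])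
    show "(\<lambda>(ys, zs). ys @ zs) ` (permutations_of_set A \<times> permutations_of_set (X - A))
        \<subseteq> {xs \<in> permutations_of_set X. set (take (card A) xs) = A}"
      using assms(2) by (auto simp: permutations_of_set_def distinct_card)
    show "(\<lambda>xs. (take (card A) xs, drop (card A) xs)) `
        {xs \<in> permutations_of_set X. set (take (card A) xs) = A}
        \<subseteq> permutations_of_set A \<times> permutations_of_set (X - A)"
    proof clarify
      fix xs assume xs: "xs \<in> permutations_of_set X" and A: "set (take (card A) xs) = A"
      have "distinct (take (card A) xs @ drop (card A) xs)"
        "set (take (card A) xs @ drop (card A) xs) = X"
        using xs by (simp_all add: permutations_of_set_def)
      then show "take (card A) xs \<in> permutations_of_set A \<and>
          drop (card A) xs \<in> permutations_of_set (X - A)"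
        unfolding distinct_append set_append permutations_of_set_def using A by auto
    qed
  qed (auto simp: permutations_of_set_def distinct_card)
  then have "card {xs \<in> permutations_of_set X. set (take (card A) xs) = A}
      = card (permutations_of_set A \<times> permutations_of_set (X - A))"
    by (simp add: bij_betw_same_card)
  then show ?thesis
    using assms finA by (simp add: card_cartesian_product card_Diff_subset)
qed

text \<open>Double counting: after swapping the sums, each \<open>A\<close> in \<open>U\<close>
  contributes its binomial weight times the number of chains through it, which is
  \<open>fact n\<close>.\<close>

lemma sum_over_maximal_chains:
  assumes "U \<subseteq> Pow {1..n}"
  shows "(\<Sum>xs\<in>permutations_of_set {1..n}. \<Sum>i | i \<le> n \<and> set (take i xs) \<in> U. n choose i)
    = fact n * card U"
proof -
  have finU: "finite U" using assms finite_subset by blast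
  have inner: "(\<Sum>i | i \<le> n \<and> set (take i xs) \<in> U. n choose i)
      = (\<Sum>A\<in>U. if set (take (card A) xs) = A then n choose card A else 0)"
    if xs: "xs \<in> permutations_of_set {1..n}" for xs
  proof -
    have card: "card (set (take i xs)) = i" if "i \<le> n" for i
    proof -
      have "length xs = n" using length_finite_permutations_of_set[OF xs] by simp
      then show ?thesis using xs that by (simp add: permutations_of_set_def distinct_card)
    qed
    have "(\<Sum>i | i \<le> n \<and> set (take i xs) \<in> U. n choose i)
        = (\<Sum>A | A \<in> U \<and> set (take (card A) xs) = A. n choose card A)"
    \<comment> \<open>A chain meets each level in exactly one set, so level and set determine each
      other.\<close>
    proof (rule sum.reindex_bij_witness[where j = "\<lambda>i. set (take i xs)" and i = card])
      fix A assume A: "A \<in> {A. A \<in> U \<and> set (take (card A) xs) = A}"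
      then have "A \<subseteq> {1..n}" using assms by auto
      then have "card A \<le> card {1..n}" by (intro card_mono) auto
      then show "card A \<in> {i. i \<le> n \<and> set (take i xs) \<in> U}" using A by simp
    qed (auto simp: card)
    also have "\<dots> = (\<Sum>A\<in>U. if set (take (card A) xs) = A then n choose card A else 0)"
      using finU by (simp add: sum.If_cases Int_def)
    finally show ?thesis .
  qed
  have "(\<Sum>xs\<in>permutations_of_set {1..n}. \<Sum>i | i \<le> n \<and> set (take i xs) \<in> U. n choose i)
      = (\<Sum>xs\<in>permutations_of_set {1..n}. \<Sum>A\<in>U.
          if set (take (card A) xs) = A then n choose card A else 0)"
    by (rule sum.cong) (simp_all only: inner)
  also have "\<dots> = (\<Sum>A\<in>U. \<Sum>xs\<in>permutations_of_set {1..n}.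
          if set (take (card A) xs) = A then n choose card A else 0)"
    by (rule sum.swap)
  also have "\<dots> = (\<Sum>A\<in>U. fact n)"
  proof (rule sum.cong)
    fix A assume "A \<in> U"
    then have A: "A \<subseteq> {1..n}" using assms by auto
    then have "card A \<le> card {1..n}" by (intro card_mono) auto
    then have le: "card A \<le> n" by simp
    have "(\<Sum>xs\<in>permutations_of_set {1..n}.
          if set (take (card A) xs) = A then n choose card A else 0)
        = card {xs \<in> permutations_of_set {1..n}. set (take (card A) xs) = A} * (n choose card A)"
      by (simp add: sum.If_cases Int_def)
    also have "\<dots> = fact n"
      using card_permutations_with_prefix[OF _ A] binomial_fact_lemma[OF le] by simp
    finally show "(\<Sum>xs\<in>permutations_of_set {1..n}.
          if set (take (card A) xs) = A then n choose card A else 0) = fact n" .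
  qed simp
  finally show ?thesis by simp
qed

section \<open>Upper bound\<close>

lemma card_path_free_le:
  assumes "0 < k" "k \<le> n" and U: "U \<subseteq> Pow {1..n}"
    and free: "\<not> contains_copy (oriented_hypercube n \<restriction> U) (directed_path k)"
  shows "card U \<le> (MAX j\<in>{1..k}. \<Sum>i | 0 \<le> i \<and> i \<le> n \<and> \<not> [i = j] (mod k). n choose i)"
    (is "_ \<le> ?M")
proof -
  have chain: "(\<Sum>i | i \<le> n \<and> set (take i xs) \<in> U. n choose i) \<le> ?M"
    if xs: "xs \<in> permutations_of_set {1..n}" for xs
  proof -
    define S where "S = {i. i \<le> n \<and> set (take i xs) \<notin> U}"
    have len: "length xs = n" using length_finite_permutations_of_set[OF xs] by simp
    have dist: "distinct xs" using xs by (simp add: permutations_of_set_def)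
    have hit: "S \<inter> {a..<a + k} \<noteq> {}" if a: "a + k \<le> n + 1" for a
    proof
      assume E: "S \<inter> {a..<a + k} = {}"
      \<comment> \<open>Path vertices are numbered from 1, so the shift by one makes
        \<open>f\<close> run through the levels \<open>a\<close> to \<open>a + k - 1\<close> of the
        chain.\<close>
      define f where "f i = set (take (a + i - 1) xs)" for i
      have "f i \<in> U" if "i \<in> {1..k}" for i
      proof -
        have "a + i - 1 \<notin> S" using E that by (auto simp: disjoint_iff)
        then show ?thesis using that a by (auto simp: S_def f_def)
      qed
      moreover have "\<exists>x. x \<notin> f i \<and> f (i + 1) = insert x (f i)" if i: "i \<in> {1..<k}" for i
      proof -
        define p where "p = a + i - 1"
        have p: "p < length xs" "a + (i + 1) - 1 = Suc p" using i a len by (auto simp: p_def)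
        have "distinct (take (Suc p) xs)" using dist by simp
        then show ?thesis
          unfolding f_def p(2) p_def[symmetric] take_Suc_conv_app_nth[OF p(1)] by auto
      qed
      ultimately show False
        using free unfolding contains_directed_path_iff[OF U] by blast
    qed
    have "\<exists>a. (\<Sum>i | i \<le> n \<and> [i = a] (mod k). n choose i) \<le> (\<Sum>i\<in>S. n choose i)"
    proof (rule residue_class_le_hitting_set[where m = "n div 2"])
      show "n choose i \<le> n choose j" if "i \<le> j" "j \<le> n div 2" for i j
        using that by (intro binomial_mono) auto
      show "n choose j \<le> n choose i" if "n div 2 \<le> i" "i \<le> j" "j \<le> n" for i j
        using that by (intro binomial_antimono)
    qed (use hit assms in \<open>auto simp: S_def\<close>)
    then obtain a where a: "(\<Sum>i | i \<le> n \<and> [i = a] (mod k). n choose i) \<le> (\<Sum>i\<in>S. n choose i)"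
      by blast
    \<comment> \<open>The representative of \<open>a\<close> is taken in \<open>{1..k}\<close>, so
      residue 0 becomes \<open>k\<close>.\<close>
    define j where "j = (if a mod k = 0 then k else a mod k)"
    have j: "j \<in> {1..k}" "[a = j] (mod k)"
      using \<open>0 < k\<close> mod_less_divisor[of k a] by (auto simp: j_def cong_def less_imp_le)
    have cong: "[i = a] (mod k) \<longleftrightarrow> [i = j] (mod k)" for i
      using j(2) by (auto simp: cong_def)
    \<comment> \<open>Taking complements in the full row turns the lower bound on the omitted weight
      into an upper bound on the weight of \<open>U\<close> along the chain.\<close>
    have split: "(\<Sum>i | i \<le> n \<and> P i. n choose i) + (\<Sum>i | i \<le> n \<and> \<not> P i. n choose i)
        = (\<Sum>i\<le>n. n choose i)" for P
    proof -
      have "{..n} = {i. i \<le> n \<and> P i} \<union> {i. i \<le> n \<and> \<not> P i}" by auto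
      then show ?thesis by (simp add: sum.union_disjoint[symmetric] disjoint_iff)
    qed
    have "(\<Sum>i | i \<le> n \<and> set (take i xs) \<in> U. n choose i)
        \<le> (\<Sum>i | i \<le> n \<and> \<not> [i = a] (mod k). n choose i)"
      using a split[of "\<lambda>i. [i = a] (mod k)"] split[of "\<lambda>i. set (take i xs) \<in> U"]
      by (simp add: S_def)
    also have "\<dots> = (\<Sum>i | 0 \<le> i \<and> i \<le> n \<and> \<not> [i = j] (mod k). n choose i)"
      by (simp add: cong)
    also have "\<dots> \<le> ?M" using j(1) by (intro Max_ge) auto
    finally show ?thesis .
  qed
  have "fact n * card U \<le> (\<Sum>xs\<in>permutations_of_set {1..n}. ?M)"
    unfolding sum_over_maximal_chains[OF U, symmetric] using chain by (rule sum_mono)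
  also have "\<dots> = fact n * ?M" by simp
  finally show ?thesis by simp
qed

section \<open>Lower bound and conclusion\<close>

text \<open>Sizes grow by one along a path, so its \<open>k\<close> vertices realise every residue
  modulo \<open>k\<close>, including the deleted one.\<close>

lemma residue_deleted_path_free:
  assumes "0 < k"
  shows "\<not> contains_copy (oriented_hypercube n \<restriction> {A \<in> Pow {1..n}. \<not> [card A = j] (mod k)})
    (directed_path k)"
proof
  let ?U = "{A \<in> Pow {1..n}. \<not> [card A = j] (mod k)}"
  have "?U \<subseteq> Pow {1..n}" by auto
  moreover assume "contains_copy (oriented_hypercube n \<restriction> ?U) (directed_path k)"
  ultimately have "\<exists>f. (\<forall>i\<in>{1..k}. f i \<in> ?U) \<and>
      (\<forall>i\<in>{1..<k}. \<exists>x. x \<notin> f i \<and> f (i + 1) = insert x (f i))"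
    by (rule contains_directed_path_iff[THEN iffD1])
  then obtain f where f: "\<forall>i\<in>{1..k}. f i \<in> ?U"
      "\<forall>i\<in>{1..<k}. \<exists>x. x \<notin> f i \<and> f (i + 1) = insert x (f i)"
    by (elim exE conjE)
  note fU = bspec[OF f(1)] and step = bspec[OF f(2)]
  have card: "card (f (d + 1)) = card (f 1) + d" if "d < k" for d
    using that
  proof (induction d)
    case (Suc d)
    obtain x where x: "x \<notin> f (d + 1)" "f (d + 1 + 1) = insert x (f (d + 1))"
      using step[of "d + 1"] Suc.prems by auto
    have "f (d + 1) \<subseteq> {1..n}" using fU[of "d + 1"] Suc.prems by auto
    then have "finite (f (d + 1))" using finite_subset by blast
    then show ?case using x Suc by simp
  qed simp
  define c where "c = card (f 1)"
  \<comment> \<open>Modulo \<open>k\<close>, the term \<open>c * (k - 1)\<close> is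
    \<open>-c\<close>, so \<open>d\<close> is the residue of \<open>j - c\<close> written without
    subtraction: \<open>d\<close> steps after a set of size \<open>c\<close> the size is congruent
    to \<open>j\<close>.\<close>
  define d where "d = (j + c * (k - 1)) mod k"
  have d: "d < k" using assms by (simp add: d_def)
  have "[c + d = c + (j + c * (k - 1))] (mod k)"
    unfolding d_def by (simp add: cong_def mod_simps)
  also have "c + (j + c * (k - 1)) = j + c * k"
    using assms by (cases k) auto
  also have "[j + c * k = j] (mod k)" by (simp add: cong_def)
  finally have "[card (f (d + 1)) = j] (mod k)" using card[OF d] by (simp add: c_def)
  then show False using fU[of "d + 1"] d by auto
qed

lemma card_subsets_with_card:
  assumes "finite X"
  shows "card {A \<in> Pow X. P (card A)} = (\<Sum>i | i \<le> card X \<and> P i. card X choose i)"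
proof -
  have "card {A \<in> Pow X. P (card A)}
      = (\<Sum>i | i \<le> card X \<and> P i. \<Sum>A | A \<in> {A \<in> Pow X. P (card A)} \<and> card A = i. 1)"
    using assms by (subst sum.group) (auto intro: card_mono)
  also have "\<dots> = (\<Sum>i | i \<le> card X \<and> P i. card X choose i)"
  proof (rule sum.cong)
    fix i assume "i \<in> {i. i \<le> card X \<and> P i}"
    then have "{A. A \<in> {A \<in> Pow X. P (card A)} \<and> card A = i} = {A. A \<subseteq> X \<and> card A = i}"
      by auto
    then show "(\<Sum>A | A \<in> {A \<in> Pow X. P (card A)} \<and> card A = i. 1) = card X choose i"
      using n_subsets[OF assms, of i] by simp
  qed simp
  finally show ?thesis .
qed

theorem theorem1p4:
  fixes k n :: nat
  assumes "0 < k" and "0 < n" and "k \<le> n"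
  shows "ex_v (directed_path k) (oriented_hypercube n) =
    (MAX j\<in>{1..k}. \<Sum>i | 0 \<le> i \<and> i \<le> n \<and> \<not> [i = j] (mod k). n choose i)"
proof -
  let ?s = "\<lambda>j. \<Sum>i | 0 \<le> i \<and> i \<le> n \<and> \<not> [i = j] (mod k). n choose i"
  let ?F = "{card U | U. U \<subseteq> verts (oriented_hypercube n) \<and>
    \<not> contains_copy (oriented_hypercube n \<restriction> U) (directed_path k)}"
  have verts: "verts (oriented_hypercube n) = Pow {1..n}" by (simp add: oriented_hypercube_def)
  have "Max ?F = Max (?s ` {1..k})"
  proof (rule Max_eqI)
    show "finite ?F" unfolding verts by simp
    show "y \<le> Max (?s ` {1..k})" if "y \<in> ?F" for y
      using that card_path_free_le[OF assms(1,3)] unfolding verts by blast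
    \<comment> \<open>The bound is attained by deleting the class of a maximising
      \<open>j\<close>.\<close>
    have "Max (?s ` {1..k}) \<in> ?s ` {1..k}" using assms by (intro Max_in) auto
    then obtain j where "Max (?s ` {1..k}) = ?s j" by blast
    also have "?s j = card {A \<in> Pow {1..n}. \<not> [card A = j] (mod k)}"
      by (subst card_subsets_with_card) auto
    finally show "Max (?s ` {1..k}) \<in> ?F"
      unfolding verts using residue_deleted_path_free[OF assms(1), of n j] by blast
  qed
  then show ?thesis by (simp add: ex_v_def)
qed

end
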